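(* Let $f\in\mathbb{R}[x,y]$ be a polynomial of degree $n\ge 2$ with homogeneous decomposition $f=\sum_{i=0}^n f_i$, and suppose that $f_n$ has $L$ real linear factors, all of them simple. If the polynomials $\nabla f_{n-1}\cdot(\nabla f_n)^{\perp}$ and $|\operatorname{Hess} f_n|$ have $K$ common real linear factors (counted up to nonzero scalars and without multiplicity), then the number of umbilic points at infinity of $f$ is at most $2L+2K$.
   Context: Notation. $f_i$ is the homogeneous part of $f$ of degree $i$; $(a,b)^{\perp}=(b,-a)$; $|\operatorname{Hess} g|=g_{xx}g_{yy}-g_{xy}^2$. The form $\Phi$. Let $F(u,v,\omega)=\sum_{i=0}^n\omega^{n-i}f_i(u,v)$ and $A=F_{uv}F_u^2-F_{uu}F_uF_v+\omega^{2(n-1)}F_{uv}$, $B=F_{vv}F_u^2-F_{uu}F_v^2+\omega^{2(n-1)}(F_{vv}-F_{uu})$, $C=F_{vv}F_uF_v-F_{uv}F_v^2-\omega^{2(n-1)}F_{uv}$. The polynomial $u^2A+uvB+v^2C$ is divisible by $\omega$; let $T\in\mathbb{R}[u,v,\omega]$ be defined by $u^2A+uvB+v^2C=\omega T$. On $\mathbb{S}^2=\{u^2+v^2+\omega^2=1\}$ consider the analytic quadratic differential form $$\Phi=\omega A\,du^2+\omega B\,du\,dv+\omega C\,dv^2-(2uA+vB)\,du\,d\omega-(uB+2vC)\,dv\,d\omega+T\,d\omega^2 .$$ It extends to $\mathbb{S}^2$ (via central projection, up to a power of $\omega$) the quadratic form on $\mathbb{R}^2$ defining the principal directions of the graph of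 $f$. A flat point of $\Phi$ is a point of $\mathbb{S}^2$ at which all coefficients of $\Phi$ vanish. An umbilic point at infinity (of $f$) is a point of the equator $\mathbb{S}^2\cap\{\omega=0\}$ that is an isolated flat point of $\Phi$. *)

theory Defs
  imports "HOL-Analysis.Analysis"
begin

text \<open>
  \<open>\<real>[x, y]\<close> is represented as \<^typ>\<open>real poly poly\<close> with \<open>y\<close> the outer variable: the coefficient of
  \<open>x\<^sup>i y\<^sup>j\<close> in \<open>f\<close> is \<open>coeff (coeff f j) i\<close>.
  \<open>\<real>[u, v, \<omega>]\<close> is represented as \<^typ>\<open>real poly poly poly\<close>, i.e. polynomials in \<open>\<omega>\<close> over
  \<open>\<real>[u, v]\<close>, where \<open>u\<close>, \<open>v\<close> take the places of \<open>x\<close>, \<open>y\<close>.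
\<close>

section \<open>Polynomials in two variables\<close>

definition total_degree :: "real poly poly \<Rightarrow> nat" where
  "total_degree f = Max (insert 0 {i + j | i j. coeff (coeff f j) i \<noteq> 0})"

definition hom_part :: "nat \<Rightarrow> real poly poly \<Rightarrow> real poly poly" where
  "hom_part d f = (\<Sum>j\<le>d. monom (monom (coeff (coeff f j) (d - j)) (d - j)) j)"

definition dx :: "real poly poly \<Rightarrow> real poly poly" where
  "dx f = map_poly pderiv f"

definition dy :: "real poly poly \<Rightarrow> real poly poly" where
  "dy f = pderiv f"

definition grad :: "real poly poly \<Rightarrow> real poly poly \<times> real poly poly" where
  "grad f = (dx f, dy f)"

definition perp :: "real poly poly \<times> real poly poly \<Rightarrow> real poly poly \<times> real poly poly" where
  "perp p = (snd p, - fst p)"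

definition dot :: "real poly poly \<times> real poly poly \<Rightarrow> real poly poly \<times> real poly poly \<Rightarrow> real poly poly" where
  "dot p q = fst p * fst q + snd p * snd q"

definition det_Hess :: "real poly poly \<Rightarrow> real poly poly" where
  "det_Hess g = dx (dx g) * dy (dy g) - (dy (dx g))^2"

definition linear_factor :: "real poly poly \<Rightarrow> real poly poly \<Rightarrow> bool" where
  "linear_factor l p \<longleftrightarrow> total_degree l = 1 \<and> l dvd p"

definition scalar_class :: "real poly poly \<Rightarrow> real poly poly set" where
  "scalar_class l = {smult [:c:] l | c. c \<noteq> 0}"

text \<open>For the set of linear factors of a nonzero polynomial this is a genuine (finite) count.\<close>

definition num_up_to_scalars :: "real poly poly set \<Rightarrow> nat" where
  "num_up_to_scalars S = card (scalar_class ` S)"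


section \<open>Polynomials in three variables\<close>

definition du :: "real poly poly poly \<Rightarrow> real poly poly poly" where
  "du = map_poly (map_poly pderiv)"

definition dv :: "real poly poly poly \<Rightarrow> real poly poly poly" where
  "dv = map_poly pderiv"

definition var_u :: "real poly poly poly" where
  "var_u = [:[:[:0, 1:]:]:]"

definition var_v :: "real poly poly poly" where
  "var_v = [:[:0, 1:]:]"

definition var_w :: "real poly poly poly" where
  "var_w = [:0, 1:]"

definition eval3 :: "real poly poly poly \<Rightarrow> real \<times> real \<times> real \<Rightarrow> real" where
  "eval3 p = (\<lambda>(u, v, w). poly (poly (poly p [:[:w:]:]) [:v:]) u)"


section \<open>The form \<open>\<Phi>\<close>\<close>

definition FF :: "real poly poly \<Rightarrow> real poly poly poly" where
  "FF f = (\<Sum>i\<le>total_degree f. monom (hom_part i f) (total_degree f - i))"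

definition AA :: "real poly poly \<Rightarrow> real poly poly poly" where
  "AA f = (let F = FF f; n = total_degree f in
     dv (du F) * (du F)^2 - du (du F) * du F * dv F + var_w ^ (2 * (n - 1)) * dv (du F))"

definition BB :: "real poly poly \<Rightarrow> real poly poly poly" where
  "BB f = (let F = FF f; n = total_degree f in
     dv (dv F) * (du F)^2 - du (du F) * (dv F)^2
       + var_w ^ (2 * (n - 1)) * (dv (dv F) - du (du F)))"

definition CC :: "real poly poly \<Rightarrow> real poly poly poly" where
  "CC f = (let F = FF f; n = total_degree f in
     dv (dv F) * du F * dv F - dv (du F) * (dv F)^2 - var_w ^ (2 * (n - 1)) * dv (du F))"

text \<open>For \<^term>\<open>total_degree f \<ge> 2\<close> the left-hand side is divisible by \<open>\<omega>\<close> (Euler's identity), so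
  \<open>TT f\<close> is well defined.\<close>

definition TT :: "real poly poly \<Rightarrow> real poly poly poly" where
  "TT f = (THE T. var_u^2 * AA f + var_u * var_v * BB f + var_v^2 * CC f = var_w * T)"

text \<open>\<open>\<Phi>\<close> is given by its coefficients at
  \<open>du\<^sup>2\<close>, \<open>du dv\<close>, \<open>dv\<^sup>2\<close>, \<open>du d\<omega>\<close>, \<open>dv d\<omega>\<close>, \<open>d\<omega>\<^sup>2\<close>, in this order.\<close>

definition Phi_coeffs :: "real poly poly \<Rightarrow> real poly poly poly list" where
  "Phi_coeffs f =
     [var_w * AA f,
      var_w * BB f,
      var_w * CC f,
      - (2 * var_u * AA f + var_v * BB f),
      - (var_u * BB f + 2 * var_v * CC f),
      TT f]"

definition flat_points :: "real poly poly \<Rightarrow> (real \<times> real \<times> real) set" where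
  "flat_points f = {p \<in> sphere 0 1. \<forall>c\<in>set (Phi_coeffs f). eval3 c p = 0}"

definition equator :: "(real \<times> real \<times> real) set" where
  "equator = {(u, v, w) \<in> sphere 0 1. w = 0}"

definition umbilics_at_infinity :: "real poly poly \<Rightarrow> (real \<times> real \<times> real) set" where
  "umbilics_at_infinity f = {p \<in> equator. p isolated_in flat_points f}"

end

theory Submission
  imports Defs "HOL-Computational_Algebra.Polynomial_Factorial"
    "HOL-Computational_Algebra.Field_as_Ring"
begin

text \<open>
  Write \<open>g = f\<^sub>n\<close>, \<open>h = f\<^sub>n\<^sub>-\<^sub>1\<close>, \<open>H = |Hess g|\<close> and \<open>J = \<nabla>h \<cdot> (\<nabla>g)\<^sup>\<bottom>\<close>. On the equator \<open>\<omega> = 0\<close> the first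
  three coefficients of \<open>\<Phi>\<close> vanish, and Euler's identity collapses the other three: as
  polynomials in \<open>u, v\<close>, they are at \<open>\<omega> = 0\<close>
  \<open>v n g H / (n - 1)\<close>, \<open>- u n g H / (n - 1)\<close> and \<open>n g J\<close>
  (\<open>mixed_coefficients_identity\<close>, \<open>last_coefficient_identity\<close>).
  Hence a flat point on the equator is a zero of \<open>g\<close> or a common zero of \<open>H\<close> and \<open>J\<close>
  (\<open>flat_point_at_infinity\<close>).

  A zero \<open>(u, v)\<close> on the unit circle of a form in two variables gives its linear factor
  \<open>v x - u y\<close> (\<open>line_through_dvd\<close>), and only the antipodal point gives the same factor up to
  scalars. So the zeros of \<open>g\<close> contribute at most \<open>2 L\<close> points and the common zeros of \<open>H\<close> and \<open>J\<close>
  at most \<open>2 K\<close> (\<open>card_circle_points_le\<close>), provided that the numbers \<open>L\<close> and \<open>K\<close>, being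
  cardinalities, count finite sets. A nonzero polynomial has finitely many divisors up to scalars
  because \<open>\<real>[x, y]\<close> is factorial, so it suffices that \<open>g \<noteq> 0\<close> and \<open>H \<noteq> 0\<close>.

  It is for \<open>H \<noteq> 0\<close> that the linear factors of \<open>g\<close> have to be simple. The Hessian is the Jacobian
  determinant of \<open>g\<^sub>x\<close> and \<open>g\<^sub>y\<close>. If it vanishes, these two forms of equal degree are linearly
  dependent (a Wronskian argument), and applying Euler's identity to \<open>g\<close> and to a first derivative
  of \<open>g\<close> exhibits the square of a linear form as a factor of \<open>g\<close>
  (\<open>repeated_factor_if_det_Hess_zero\<close>).
\<close>

section \<open>Derivatives and homogeneous polynomials in two variables\<close>

definition xx :: "real poly poly" where "xx = [:[:0, 1:]:]"

definition yy :: "real poly poly" where "yy = [:0, 1:]"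

definition eval2 :: "real poly poly \<Rightarrow> real \<Rightarrow> real \<Rightarrow> real" where
  "eval2 p u v = poly (poly p [:v:]) u"

lemma eval2_simps [simp]:
  "eval2 0 u v = 0" "eval2 xx u v = u" "eval2 yy u v = v"
  "eval2 (p + q) u v = eval2 p u v + eval2 q u v"
  "eval2 (p - q) u v = eval2 p u v - eval2 q u v"
  "eval2 (- p) u v = - eval2 p u v"
  "eval2 (p * q) u v = eval2 p u v * eval2 q u v"
  "eval2 (p ^ k) u v = eval2 p u v ^ k"
  "eval2 (of_nat k) u v = of_nat k"
  "eval2 (numeral m) u v = numeral m"
  by (simp_all add: eval2_def xx_def yy_def)

lemma eval2_sum: "eval2 (sum f S) u v = (\<Sum>i\<in>S. eval2 (f i) u v)"
  by (simp add: eval2_def poly_sum)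

lemma eval2_monom: "eval2 (monom (monom c i) j) u v = c * u ^ i * v ^ j"
  by (simp add: eval2_def poly_monom)

lemma coeff_dx [simp]: "coeff (dx p) j = pderiv (coeff p j)"
  by (simp add: dx_def coeff_map_poly)

lemma coeff_dy [simp]: "coeff (dy p) j = of_nat (Suc j) * coeff p (Suc j)"
  by (simp add: dy_def coeff_pderiv)

lemma of_nat_mult_coeff: "coeff (of_nat k * p) i = of_nat k * coeff p i"
  for p :: "'a::comm_semiring_1 poly"
  by (simp add: of_nat_poly)

lemma dx_smult [simp]: "dx (smult [:c:] p) = smult [:c:] (dx p)"
  by (intro poly_eqI) (simp add: pderiv_smult)

lemma dy_smult [simp]: "dy (smult c p) = smult c (dy p)"
  by (simp add: dy_def pderiv_smult)

lemma dy_0 [simp]: "dy 0 = 0"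
  by (simp add: dy_def)

lemma dx_dy_commute: "dx (dy p) = dy (dx p)"
  by (intro poly_eqI) (simp add: of_nat_poly pderiv_smult)

definition homogeneous :: "nat \<Rightarrow> real poly poly \<Rightarrow> bool" where
  "homogeneous d p \<longleftrightarrow> (\<forall>i j. coeff (coeff p j) i \<noteq> 0 \<longrightarrow> i + j = d)"

lemma homogeneousD: "homogeneous d p \<Longrightarrow> i + j \<noteq> d \<Longrightarrow> coeff (coeff p j) i = 0"
  by (auto simp: homogeneous_def)

lemma homogeneous_diff: "homogeneous d p \<Longrightarrow> homogeneous d q \<Longrightarrow> homogeneous d (p - q)"
  unfolding homogeneous_def by (metis coeff_diff diff_self)

lemma homogeneous_smult: "homogeneous d p \<Longrightarrow> homogeneous d (smult [:c:] p)"
  by (auto simp: homogeneous_def)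

lemma homogeneous_mult:
  assumes "homogeneous d p" "homogeneous e q"
  shows "homogeneous (d + e) (p * q)"
  unfolding homogeneous_def
proof (intro allI impI)
  fix i j
  assume "coeff (coeff (p * q) j) i \<noteq> 0"
  then have "(\<Sum>k\<le>j. \<Sum>m\<le>i. coeff (coeff p k) m * coeff (coeff q (j - k)) (i - m)) \<noteq> 0"
    by (simp add: coeff_mult coeff_sum)
  then obtain k m where "k \<le> j" "m \<le> i"
    and "coeff (coeff p k) m * coeff (coeff q (j - k)) (i - m) \<noteq> 0"
    by (meson atMost_iff sum.not_neutral_contains_not_neutral)
  moreover from this have "m + k = d" "(i - m) + (j - k) = e"
    using assms by (auto simp: homogeneous_def)
  ultimately show "i + j = d + e"
    by linarith
qed

lemma homogeneous_dx: "homogeneous d p \<Longrightarrow> homogeneous (d - 1) (dx p)"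
  by (fastforce simp: homogeneous_def coeff_pderiv)

lemma homogeneous_dy: "homogeneous d p \<Longrightarrow> homogeneous (d - 1) (dy p)"
  by (fastforce simp: homogeneous_def of_nat_mult_coeff simp del: of_nat_Suc)

lemma coeff_hom_part:
  "coeff (coeff (hom_part d f) j) i = (if i + j = d then coeff (coeff f j) i else 0)"
  by (auto simp: hom_part_def coeff_sum if_distrib[of "\<lambda>p. coeff p i"] cong: if_cong)

lemma homogeneous_hom_part: "homogeneous d (hom_part d f)"
  by (auto simp: homogeneous_def coeff_hom_part)

lemma hom_part_homogeneous: "homogeneous d p \<Longrightarrow> hom_part d p = p"
  by (intro poly_eqI) (simp add: coeff_hom_part homogeneousD)

lemma euler_homogeneous:
  assumes "homogeneous d p"
  shows "xx * dx p + yy * dy p = of_nat d * p"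
proof (intro poly_eqI)
  fix j i
  have "coeff (coeff (xx * dx p + yy * dy p) j) i = real (i + j) * coeff (coeff p j) i"
    by (cases i; cases j)
       (simp_all add: xx_def yy_def coeff_pCons coeff_pderiv of_nat_mult_coeff algebra_simps)
  also have "\<dots> = real d * coeff (coeff p j) i"
    using homogeneousD[OF assms, of i j] by (cases "i + j = d") auto
  also have "\<dots> = coeff (coeff (of_nat d * p) j) i"
    by (simp only: of_nat_mult_coeff)
  finally show "coeff (coeff (xx * dx p + yy * dy p) j) i = coeff (coeff (of_nat d * p) j) i" .
qed

lemma euler_at_point:
  assumes "homogeneous d p"
  shows "u * eval2 (dx p) u v + v * eval2 (dy p) u v = real d * eval2 p u v"
  using arg_cong[OF euler_homogeneous[OF assms], of "\<lambda>q. eval2 q u v"] by simp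

lemma finite_support:
  "finite {i + j | i j. coeff (coeff (f :: real poly poly) j) i \<noteq> 0}"
proof (rule finite_subset)
  show "{i + j | i j. coeff (coeff f j) i \<noteq> 0}
      \<subseteq> (\<Union>j\<le>degree f. (\<lambda>i. i + j) ` {..degree (coeff f j)})"
  proof safe
    fix i j assume "coeff (coeff f j) i \<noteq> 0"
    then have "j \<le> degree f" "i \<le> degree (coeff f j)"
      by (auto intro: le_degree)
    then show "i + j \<in> (\<Union>j\<le>degree f. (\<lambda>i. i + j) ` {..degree (coeff f j)})"
      by blast
  qed
qed auto

lemma hom_part_total_degree_nonzero:
  assumes "total_degree f = n" "n > 0"
  shows "hom_part n f \<noteq> 0"
proof -
  have "n \<in> insert 0 {i + j | i j. coeff (coeff f j) i \<noteq> 0}"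
    using Max_in[of "insert 0 {i + j | i j. coeff (coeff f j) i \<noteq> 0}"] finite_support[of f]
      assms(1) unfolding total_degree_def by auto
  with assms(2) obtain i j where "i + j = n" "coeff (coeff f j) i \<noteq> 0"
    by auto
  then show ?thesis
    using coeff_hom_part[of n f j i] by auto
qed

lemma total_degree_homogeneous:
  assumes "homogeneous d p" "p \<noteq> 0"
  shows "total_degree p = d"
proof -
  from assms(2) obtain i j where "coeff (coeff p j) i \<noteq> 0"
    by (metis leading_coeff_0_iff)
  with assms(1) have "{i + j | i j. coeff (coeff p j) i \<noteq> 0} = {d}"
    by (auto simp: homogeneous_def)
  then show ?thesis
    by (simp add: total_degree_def)
qed

section \<open>Linear factors and zeros on the circle\<close>

text \<open>The linear form \<open>v x - u y\<close>, which for \<open>(u, v) \<noteq> (0, 0)\<close> cuts out the line through the origin and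
  \<open>(u, v)\<close>.\<close>

definition line_through :: "real \<times> real \<Rightarrow> real poly poly" where
  "line_through = (\<lambda>(u, v). [:[:0, v:], [:- u:]:])"

lemma line_through_alt: "line_through (u, v) = [:[:v:]:] * xx - [:[:u:]:] * yy"
  by (simp add: line_through_def xx_def yy_def)

lemma total_degree_line_through:
  assumes "z \<noteq> (0, 0)"
  shows "total_degree (line_through z) = 1"
proof (rule total_degree_homogeneous)
  show "homogeneous 1 (line_through z)"
    by (auto simp: homogeneous_def line_through_def coeff_pCons split: nat.splits prod.splits)
  show "line_through z \<noteq> 0"
    using assms by (auto simp: line_through_def split: prod.splits)
qed

text \<open>Modulo the linear form, \<open>v x\<close> and \<open>u y\<close> are equal. Hence \<open>u\<^sup>d p\<close> is congruent to \<open>p(u, v) x\<^sup>d = 0\<close>,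
  and \<open>v\<^sup>d p\<close> to \<open>p(u, v) y\<^sup>d = 0\<close>; one of the scalars \<open>u\<close>, \<open>v\<close> is invertible.\<close>

lemma line_through_dvd:
  assumes hom: "homogeneous d p" and zero: "eval2 p u v = 0" and nz: "(u, v) \<noteq> (0, 0)"
  shows "line_through (u, v) dvd p"
proof -
  define c :: "real \<Rightarrow> real poly poly" where "c r = [:[:r:]:]" for r
  define a where "a j = coeff (coeff p j) (d - j)" for j
  let ?l = "line_through (u, v)"
  have c_mult: "c (r * s) = c r * c s" and c_add: "c (r + s) = c r + c s" and c_0: "c 0 = 0" for r s
    by (simp_all add: c_def)
  have c_power: "c (r ^ k) = c r ^ k" for r k
    by (induction k) (simp_all add: c_mult, simp add: c_def one_pCons)
  have c_sum: "c (sum f S) = (\<Sum>i\<in>S. c (f i))" for f and S :: "nat set"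
    by (induction S rule: infinite_finite_induct) (simp_all add: c_0 c_add)
  have p: "p = (\<Sum>j\<le>d. c (a j) * (xx ^ (d - j) * yy ^ j))"
  proof -
    have "monom (monom r i) j = c r * (xx ^ i * yy ^ j)" for r i j
      by (simp add: monom_altdef poly_const_pow c_def xx_def yy_def)
    then show ?thesis
      using hom_part_homogeneous[OF hom] by (simp add: hom_part_def a_def)
  qed
  have "(\<Sum>j\<le>d. a j * u ^ (d - j) * v ^ j) = 0"
    using zero arg_cong[OF hom_part_homogeneous[OF hom], of "\<lambda>q. eval2 q u v"]
    by (simp add: hom_part_def eval2_sum eval2_monom a_def)
  from arg_cong[OF this, of c] have eval: "(\<Sum>j\<le>d. c (a j) * c u ^ (d - j) * c v ^ j) = 0"
    by (simp add: c_sum c_mult c_power c_0)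
  have l: "?l = c v * xx - c u * yy"
    by (simp add: line_through_alt c_def)
  have power_diff: "?l dvd (c v * xx) ^ k - (c u * yy) ^ k" for k
    unfolding l by (subst power_diff_sumr2) simp
  have dvd_scaled: "?l dvd w * p"
    if "\<And>j. j \<le> d \<Longrightarrow>
          ?l dvd w * (c (a j) * (xx ^ (d - j) * yy ^ j)) - c (a j) * c u ^ (d - j) * c v ^ j * W"
    for w W
  proof -
    have "w * p = (\<Sum>j\<le>d. w * (c (a j) * (xx ^ (d - j) * yy ^ j)))
        - (\<Sum>j\<le>d. c (a j) * c u ^ (d - j) * c v ^ j) * W"
      unfolding eval by (subst p) (simp add: sum_distrib_left)
    also have "\<dots> = (\<Sum>j\<le>d. w * (c (a j) * (xx ^ (d - j) * yy ^ j))
        - c (a j) * c u ^ (d - j) * c v ^ j * W)"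
      by (simp only: sum_subtractf sum_distrib_right)
    also have "?l dvd \<dots>"
      by (rule dvd_sum) (use that in auto)
    finally show ?thesis .
  qed
  have unit: "?l dvd p" if "?l dvd c r * p" "r \<noteq> 0" for r
  proof -
    have "c (1 / r) * c r = 1"
      using that(2) by (simp add: c_def one_pCons)
    then have "c (1 / r) * (c r * p) = p"
      by (simp flip: mult.assoc)
    then show ?thesis
      using that(1) by (metis dvd_mult)
  qed
  show ?thesis
  proof (cases "u = 0")
    case False
    have "?l dvd c u ^ d * p"
    proof (rule dvd_scaled)
      fix j assume "j \<le> d"
      then have split: "z ^ d = z ^ (d - j) * z ^ j" for z :: "real poly poly"
        by (simp flip: power_add)
      have "c u ^ d * (c (a j) * (xx ^ (d - j) * yy ^ j)) - c (a j) * c u ^ (d - j) * c v ^ j * xx ^ d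
          = - (c (a j) * c u ^ (d - j) * xx ^ (d - j)) * ((c v * xx) ^ j - (c u * yy) ^ j)"
        unfolding split power_mult_distrib by (simp add: algebra_simps)
      then show "?l dvd c u ^ d * (c (a j) * (xx ^ (d - j) * yy ^ j))
          - c (a j) * c u ^ (d - j) * c v ^ j * xx ^ d"
        using power_diff[of j] by (metis dvd_mult)
    qed
    then show ?thesis
      using unit[of "u ^ d"] False by (simp add: c_power)
  next
    case True
    have "?l dvd c v ^ d * p"
    proof (rule dvd_scaled)
      fix j assume "j \<le> d"
      then have split: "z ^ d = z ^ (d - j) * z ^ j" for z :: "real poly poly"
        by (simp flip: power_add)
      have "c v ^ d * (c (a j) * (xx ^ (d - j) * yy ^ j)) - c (a j) * c u ^ (d - j) * c v ^ j * yy ^ d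
          = (c (a j) * c v ^ j * yy ^ j) * ((c v * xx) ^ (d - j) - (c u * yy) ^ (d - j))"
        unfolding split power_mult_distrib by (simp add: algebra_simps)
      then show "?l dvd c v ^ d * (c (a j) * (xx ^ (d - j) * yy ^ j))
          - c (a j) * c u ^ (d - j) * c v ^ j * yy ^ d"
        using power_diff[of "d - j"] by (metis dvd_mult)
    qed
    then show ?thesis
      using unit[of "v ^ d"] True nz by (simp add: c_power)
  qed
qed

text \<open>Up to units, which are the nonzero scalars, a divisor of \<open>p\<close> is the product of a sub-multiset of
  the prime factors of \<open>p\<close>.\<close>

lemma finite_scalar_classes_of_divisors:
  assumes "p \<noteq> 0"
  shows "finite (scalar_class ` {l. l dvd p})"
proof -
  define D where "D = {d. d dvd p \<and> normalize d = d}"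
  have "finite {M. M \<subseteq># prime_factorization p}"
  proof (rule finite_subset)
    let ?N = "prime_factorization p"
    show "{M. M \<subseteq># ?N} \<subseteq> mset ` {xs. set xs \<subseteq> set_mset ?N \<and> length xs \<le> size ?N}"
    proof
      fix M assume "M \<in> {M. M \<subseteq># ?N}"
      moreover obtain xs where "M = mset xs" by (metis ex_mset)
      ultimately show "M \<in> mset ` {xs. set xs \<subseteq> set_mset ?N \<and> length xs \<le> size ?N}"
        using set_mset_mono[of M ?N] size_mset_mono[of M ?N] by auto
    qed
  qed (simp add: finite_lists_length_le)
  moreover have "D \<subseteq> (\<lambda>M. normalize (prod_mset M)) ` {M. M \<subseteq># prime_factorization p}"
  proof
    fix d assume "d \<in> D"
    then have d: "d dvd p" "normalize d = d" "d \<noteq> 0"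
      using assms by (auto simp: D_def)
    then have "prime_factorization d \<subseteq># prime_factorization p"
      using assms by (simp add: prime_factorization_subset_iff_dvd)
    then show "d \<in> (\<lambda>M. normalize (prod_mset M)) ` {M. M \<subseteq># prime_factorization p}"
      using d by (auto intro!: image_eqI[of _ _ "prime_factorization d"]
          simp: prod_mset_prime_factorization_weak)
  qed
  ultimately have "finite D"
    by (metis finite_imageI finite_subset)
  moreover have "scalar_class ` {l. l dvd p} \<subseteq> scalar_class ` D"
  proof safe
    fix l assume l: "l dvd p"
    obtain e where e: "e dvd 1" "l = e * normalize l"
      by (metis associatedE1 normalize_idem)
    from e(1) obtain c where c: "e = [:[:c:]:]" "c \<noteq> 0"
      by (auto simp: is_unit_poly_iff dvd_field_iff)
    have l': "l = smult [:c:] (normalize l)"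
      using e(2) c(1) by simp
    have "scalar_class l = scalar_class (normalize l)"
      unfolding scalar_class_def
    proof safe
      fix r :: real assume "r \<noteq> 0"
      show "\<exists>s. smult [:r:] l = smult [:s:] (normalize l) \<and> s \<noteq> 0"
        using \<open>r \<noteq> 0\<close> c(2) by (subst l') (auto intro!: exI[of _ "r * c"] simp: mult.commute)
      show "\<exists>s. smult [:r:] (normalize l) = smult [:s:] l \<and> s \<noteq> 0"
        using \<open>r \<noteq> 0\<close> c(2)
        by (subst (2) l') (auto intro!: exI[of _ "r / c"])
    qed
    then show "scalar_class l \<in> scalar_class ` D"
      using l by (auto simp: D_def)
  qed
  ultimately show ?thesis
    by (metis finite_imageI finite_subset)
qed

lemma scalar_class_line_through_eqD:
  assumes "scalar_class (line_through z) = scalar_class (line_through z')"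
    and z: "z \<in> sphere 0 1" and z': "z' \<in> sphere 0 1"
  shows "z = z' \<or> z = - z'"
proof -
  have "line_through z \<in> scalar_class (line_through z)"
    by (auto simp: scalar_class_def intro!: exI[of _ 1] simp flip: one_pCons)
  then obtain c where "line_through z = smult [:c:] (line_through z')"
    unfolding assms(1) by (auto simp: scalar_class_def)
  then have c: "fst z = c * fst z'" "snd z = c * snd z'"
    by (auto simp: line_through_def split: prod.splits)
  have zz: "z = c *\<^sub>R z'"
    using c by (simp add: prod_eq_iff)
  with z z' have "\<bar>c\<bar> = 1"
    by simp
  then show ?thesis
    using zz by (auto simp: abs_if split: if_splits)
qed

text \<open>The map from points to classes of linear forms has fibres contained in antipodal pairs.
  Finiteness has to be assumed, since otherwise the count on the right would be zero.\<close>

lemma card_circle_points_le: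
  assumes "finite (scalar_class ` S)" and Z: "Z \<subseteq> sphere 0 1"
    and ZS: "\<And>z. z \<in> Z \<Longrightarrow> line_through z \<in> S"
  shows "finite Z \<and> card Z \<le> 2 * num_up_to_scalars S"
proof -
  define fib where "fib \<kappa> = {z \<in> Z. scalar_class (line_through z) = \<kappa>}" for \<kappa>
  have fib: "finite (fib \<kappa>) \<and> card (fib \<kappa>) \<le> 2" for \<kappa>
  proof (cases "fib \<kappa> = {}")
    case False
    then obtain z where z: "z \<in> fib \<kappa>" by auto
    have "fib \<kappa> \<subseteq> {z, - z}"
    proof
      fix z' assume "z' \<in> fib \<kappa>"
      with z Z show "z' \<in> {z, - z}"
        using scalar_class_line_through_eqD[of z' z] unfolding fib_def by blast
    qed
    moreover have "card {z, - z} \<le> 2"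
      by (simp add: card_insert_if)
    ultimately show ?thesis
      by (meson card_mono finite.emptyI finite.insertI finite_subset le_trans)
  qed auto
  have cover: "Z = (\<Union>\<kappa>\<in>scalar_class ` S. fib \<kappa>)"
    using ZS by (auto simp: fib_def)
  have "finite Z"
    using finite_UN_I[OF assms(1), of fib] fib cover by metis
  moreover have "card Z \<le> (\<Sum>\<kappa>\<in>scalar_class ` S. card (fib \<kappa>))"
    by (subst cover) (rule card_UN_le[OF assms(1)])
  moreover have "(\<Sum>\<kappa>\<in>scalar_class ` S. card (fib \<kappa>)) \<le> card (scalar_class ` S) * 2"
    using sum_bounded_above[of "scalar_class ` S" "\<lambda>\<kappa>. card (fib \<kappa>)" 2] fib by simp
  ultimately show ?thesis
    by (simp add: num_up_to_scalars_def)
qed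

section \<open>A vanishing Hessian forces a repeated linear factor\<close>

text \<open>The top coefficient of the Wronskian is the product of the leading coefficients and the
  difference of the degrees.\<close>

lemma degree_eq_if_wronskian_zero:
  fixes p q :: "'a::{idom, semiring_char_0} poly"
  assumes W: "pderiv p * q = p * pderiv q" and nz: "p \<noteq> 0" "q \<noteq> 0"
  shows "degree p = degree q"
proof (cases "degree p = 0 \<or> degree q = 0")
  case True
  then have "pderiv p = 0 \<and> pderiv q = 0"
    using W nz by (metis mult_eq_0_iff mult_zero_left mult_zero_right pderiv_eq_0_iff)
  then show ?thesis
    by (simp add: pderiv_eq_0_iff)
next
  case False
  then have "degree (pderiv p) + degree q = degree p + degree (pderiv q)"
    by (simp add: degree_pderiv)
  with W have "lead_coeff (pderiv p) * lead_coeff q = lead_coeff p * lead_coeff (pderiv q)"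
    by (metis lead_coeff_mult)
  with False nz show ?thesis
    by (simp add: degree_pderiv coeff_pderiv del: of_nat_Suc)
qed

text \<open>Subtract the multiple of \<open>p\<close> that cancels the leading term of \<open>q\<close>. The Wronskian of \<open>p\<close> with the
  remainder still vanishes, but the degrees now differ, so the remainder is zero.\<close>

lemma proportional_if_wronskian_zero:
  fixes p q :: "'a::field_char_0 poly"
  assumes W: "pderiv p * q = p * pderiv q" and "p \<noteq> 0"
  shows "\<exists>c. q = smult c p"
proof (cases "q = 0")
  case True
  then show ?thesis by (auto intro: exI[of _ 0])
next
  case False
  then have deg: "degree p = degree q"
    using degree_eq_if_wronskian_zero[OF W \<open>p \<noteq> 0\<close>] by simp
  define c where "c = lead_coeff q / lead_coeff p"
  define r where "r = q - smult c p"
  have "pderiv p * r = p * pderiv r"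
    using W by (simp add: r_def pderiv_diff pderiv_smult algebra_simps)
  moreover have "coeff r (degree p) = 0"
    using \<open>p \<noteq> 0\<close> by (simp add: r_def c_def flip: deg)
  ultimately have "r = 0"
    using degree_eq_if_wronskian_zero[of p r] \<open>p \<noteq> 0\<close> by force
  then show ?thesis by (auto simp: r_def)
qed

text \<open>Evaluation of the outer variable \<open>y\<close> at \<open>1\<close> dehomogenizes. It is injective on forms of a given
  degree, which makes the univariate result on Wronskians available for forms.\<close>

lemma poly_dx_1: "poly (dx p) 1 = pderiv (poly p 1)"
  by (induction p) (simp_all add: dx_def map_poly_pCons pderiv_add)

lemma homogeneous_eq_0_iff:
  assumes "homogeneous d p"
  shows "poly p 1 = 0 \<longleftrightarrow> p = 0"
proof
  assume zero: "poly p 1 = 0"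
  show "p = 0"
  proof (rule ccontr)
    assume "p \<noteq> 0"
    then obtain i j where ij: "coeff (coeff p j) i \<noteq> 0"
      by (metis leading_coeff_0_iff)
    then have "j \<le> degree p"
      by (metis coeff_0 le_degree)
    have "coeff (poly p 1) i = (\<Sum>k\<le>degree p. coeff (coeff p k) i)"
      by (simp add: poly_altdef coeff_sum)
    also have "\<dots> = (\<Sum>k\<le>degree p. if k = j then coeff (coeff p j) i else 0)"
      using assms ij by (intro sum.cong) (auto simp: homogeneous_def, metis add_left_imp_eq)
    also have "\<dots> = coeff (coeff p j) i"
      using \<open>j \<le> degree p\<close> by simp
    finally show False
      using ij zero by simp
  qed
qed simp

text \<open>For forms of the same degree \<open>m\<close>, Euler's identity expresses \<open>\<partial>/\<partial>y\<close> at \<open>y = 1\<close> through \<open>\<partial>/\<partial>x\<close>,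
  and the dehomogenized Jacobian determinant becomes \<open>m\<close> times the Wronskian.\<close>

lemma proportional_if_jacobian_zero:
  assumes hom: "homogeneous m p" "homogeneous m q" and "m > 0"
    and J: "dx p * dy q = dy p * dx q" and "p \<noteq> 0"
  shows "\<exists>c. q = smult [:c:] p"
proof -
  let ?E = "\<lambda>p::real poly poly. poly p 1"
  have E_dy: "?E (dy r) = of_nat m * ?E r - [:0, 1:] * pderiv (?E r)" if "homogeneous m r" for r
    using arg_cong[OF euler_homogeneous[OF that], of ?E]
    by (simp add: poly_dx_1 xx_def yy_def algebra_simps)
  have "pderiv (?E p) * ?E (dy q) = ?E (dy p) * pderiv (?E q)"
    using arg_cong[OF J, of ?E] by (simp add: poly_dx_1)
  then have "of_nat m * (pderiv (?E p) * ?E q) = of_nat m * (?E p * pderiv (?E q))"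
    unfolding E_dy[OF hom(1)] E_dy[OF hom(2)] by algebra
  then have "pderiv (?E p) * ?E q = ?E p * pderiv (?E q)"
    using \<open>m > 0\<close> by simp
  moreover have "?E p \<noteq> 0"
    using homogeneous_eq_0_iff[OF hom(1)] \<open>p \<noteq> 0\<close> by simp
  ultimately obtain c where "?E q = smult c (?E p)"
    using proportional_if_wronskian_zero by blast
  then have "?E (q - smult [:c:] p) = 0"
    by simp
  then have "q - smult [:c:] p = 0"
    using homogeneous_eq_0_iff[OF homogeneous_diff[OF hom(2) homogeneous_smult[OF hom(1)]]] by blast
  then show ?thesis by auto
qed

lemma of_nat_mult_dvd_cancel:
  fixes p l :: "real poly poly"
  assumes "l dvd of_nat k * p" "k > 0"
  shows "l dvd p"
proof -
  have "(of_nat k :: real poly poly) = [:[:of_nat k:]:]"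
    by (simp add: of_nat_poly)
  then have "is_unit (of_nat k :: real poly poly)"
    using assms(2) by (simp add: is_unit_pCons_iff is_unit_const_poly_iff)
  then show ?thesis
    using assms(1) by (simp add: dvd_mult_unit_iff')
qed

text \<open>If \<open>g\<^sub>x = 0\<close>, then \<open>n (n - 1) g = y\<^sup>2 g\<^sub>y\<^sub>y\<close>. Otherwise \<open>g\<^sub>y = c g\<^sub>x\<close> for a scalar \<open>c\<close>, and
  \<open>n (n - 1) g = (x + c y)\<^sup>2 g\<^sub>x\<^sub>x\<close>. Both come from two applications of Euler's identity.\<close>

lemma repeated_factor_if_det_Hess_zero:
  assumes hom: "homogeneous n g" and "n \<ge> 2" and H: "det_Hess g = 0"
  shows "\<exists>l. total_degree l = 1 \<and> l\<^sup>2 dvd g"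
proof (cases "dx g = 0")
  case True
  have gy: "homogeneous (n - 1) (dy g)"
    by (rule homogeneous_dy[OF hom])
  have "of_nat (n * (n - 1)) * g = of_nat (n - 1) * (of_nat n * g)"
    by (simp add: mult_ac)
  also have "\<dots> = of_nat (n - 1) * (yy * dy g)"
    using euler_homogeneous[OF hom] True by simp
  also have "\<dots> = yy * (of_nat (n - 1) * dy g)"
    by (simp only: mult_ac)
  also have "\<dots> = yy\<^sup>2 * dy (dy g)"
    unfolding euler_homogeneous[OF gy, symmetric] dx_dy_commute True
    by (simp add: power2_eq_square mult_ac)
  finally have "yy\<^sup>2 dvd of_nat (n * (n - 1)) * g"
    by simp
  then have "yy\<^sup>2 dvd g"
    by (rule of_nat_mult_dvd_cancel) (use \<open>n \<ge> 2\<close> in simp)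
  moreover have "total_degree yy = 1"
    by (rule total_degree_homogeneous)
       (auto simp: yy_def homogeneous_def coeff_pCons split: nat.splits)
  ultimately show ?thesis by blast
next
  case False
  have gx: "homogeneous (n - 1) (dx g)"
    by (rule homogeneous_dx[OF hom])
  have "dx (dx g) * dy (dy g) = dy (dx g) * dx (dy g)"
    using H by (simp add: det_Hess_def power2_eq_square dx_dy_commute)
  then obtain c where c: "dy g = smult [:c:] (dx g)"
    using proportional_if_jacobian_zero[OF gx homogeneous_dy[OF hom]] False \<open>n \<ge> 2\<close> by auto
  define l where "l = xx + smult [:c:] yy"
  have "of_nat (n * (n - 1)) * g = of_nat (n - 1) * (of_nat n * g)"
    by (simp add: mult_ac)
  also have "\<dots> = of_nat (n - 1) * (l * dx g)"
    unfolding euler_homogeneous[OF hom, symmetric] c l_def by (simp add: algebra_simps)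
  also have "\<dots> = l * (of_nat (n - 1) * dx g)"
    by (simp only: mult_ac)
  also have "of_nat (n - 1) * dx g = l * dx (dx g)"
    unfolding euler_homogeneous[OF gx, symmetric] dx_dy_commute[symmetric] c l_def
    by (simp add: algebra_simps)
  finally have "l\<^sup>2 dvd of_nat (n * (n - 1)) * g"
    by (simp add: power2_eq_square mult.assoc)
  then have "l\<^sup>2 dvd g"
    by (rule of_nat_mult_dvd_cancel) (use \<open>n \<ge> 2\<close> in simp)
  moreover have "total_degree l = 1"
    by (rule total_degree_homogeneous)
       (auto simp: l_def xx_def yy_def homogeneous_def coeff_pCons split: nat.splits)
  ultimately show ?thesis by blast
qed

section \<open>The coefficients of the form along the equator\<close>

lemma eval3_equator: "eval3 p (u, v, 0) = eval2 (coeff p 0) u v"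
  by (simp add: eval3_def eval2_def poly_0_coeff_0)

lemma coeff_du [simp]: "coeff (du p) k = dx (coeff p k)"
proof -
  have "map_poly pderiv 0 = (0 :: real poly poly)" by simp
  then show ?thesis by (simp add: du_def dx_def coeff_map_poly)
qed

lemma coeff_dv [simp]: "coeff (dv p) k = dy (coeff p k)"
  by (simp add: dv_def dy_def coeff_map_poly)

lemma coeff_FF:
  assumes k: "k \<le> total_degree f"
  shows "coeff (FF f) k = hom_part (total_degree f - k) f"
proof -
  have "coeff (FF f) k = (\<Sum>i\<le>total_degree f. if i = total_degree f - k then hom_part i f else 0)"
    unfolding FF_def coeff_sum by (rule sum.cong) (use k in auto)
  then show ?thesis by simp
qed

lemma coeff_mult_Suc_0:
  "coeff (p * q) (Suc 0) = coeff p 0 * coeff q (Suc 0) + coeff p (Suc 0) * coeff q 0"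
  for p q :: "'a::comm_semiring_0 poly"
  by (simp add: coeff_mult)

lemma coeff_two_0: "coeff (2 :: 'a::comm_semiring_1 poly) 0 = 2"
  by (simp add: numeral_poly)

lemma coeff_var_w_power: "k < m \<Longrightarrow> coeff (var_w ^ m) k = 0"
  by (metis coeff_monom less_irrefl monom_altdef smult_1_left var_w_def)

text \<open>For \<open>n \<ge> 2\<close> the summands with the factor \<open>\<omega>\<^bsup>2(n-1)\<^esup>\<close> affect neither the coefficient of \<open>\<omega>\<^sup>0\<close>
  nor that of \<open>\<omega>\<^sup>1\<close>. The former depends on \<open>f\<^sub>n\<close> only, the latter also on \<open>f\<^sub>n\<^sub>-\<^sub>1\<close>.\<close>

lemma coeff_AA_BB_CC_0:
  assumes "total_degree f = n" "n \<ge> 2"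
  defines "g \<equiv> hom_part n f"
  shows "coeff (AA f) 0 = dy (dx g) * (dx g)\<^sup>2 - dx (dx g) * dx g * dy g"
    and "coeff (BB f) 0 = dy (dy g) * (dx g)\<^sup>2 - dx (dx g) * (dy g)\<^sup>2"
    and "coeff (CC f) 0 = dy (dy g) * dx g * dy g - dy (dx g) * (dy g)\<^sup>2"
  using assms(1,2) coeff_FF[of 0 f]
  by (simp_all add: AA_def BB_def CC_def Let_def g_def coeff_mult_0 coeff_var_w_power
      power2_eq_square)

lemma coeff_AA_BB_CC_1:
  assumes "total_degree f = n" "n \<ge> 2"
  defines "g \<equiv> hom_part n f" and "h \<equiv> hom_part (n - 1) f"
  shows "coeff (AA f) (Suc 0) = dy (dx h) * (dx g)\<^sup>2 + 2 * dy (dx g) * dx g * dx h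
      - dx (dx h) * dx g * dy g - dx (dx g) * dx h * dy g - dx (dx g) * dx g * dy h"
    and "coeff (BB f) (Suc 0) = dy (dy h) * (dx g)\<^sup>2 + 2 * dy (dy g) * dx g * dx h
      - dx (dx h) * (dy g)\<^sup>2 - 2 * dx (dx g) * dy g * dy h"
    and "coeff (CC f) (Suc 0) = dy (dy h) * dx g * dy g + dy (dy g) * dx h * dy g
      + dy (dy g) * dx g * dy h - dy (dx h) * (dy g)\<^sup>2 - 2 * dy (dx g) * dy g * dy h"
  using assms(1,2) coeff_FF[of 0 f] coeff_FF[of "Suc 0" f]
  by (simp_all add: AA_def BB_def CC_def Let_def g_def h_def coeff_mult_0 coeff_mult_Suc_0
      coeff_var_w_power power2_eq_square algebra_simps)

text \<open>Here and in the two identities used for the other coefficients, \<open>p, q\<close> stand for the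
  first and \<open>r, s, t\<close> for the second derivatives of \<open>g\<close>, and primed letters for those of \<open>h\<close>; the hypotheses are Euler's identities,
  with \<open>m = n - 1\<close> and \<open>N = n\<close>. The present one makes \<open>u\<^sup>2 A + u v B + v\<^sup>2 C\<close> divisible by \<open>\<omega>\<close>.\<close>

lemma radial_contraction_vanishes:
  fixes u v m p q r s t :: "'a::idom"
  assumes "u * r + v * s = m * p" and "u * s + v * t = m * q"
  shows "u\<^sup>2 * (s * p\<^sup>2 - r * p * q) + u * v * (t * p\<^sup>2 - r * q\<^sup>2)
      + v\<^sup>2 * (t * p * q - s * q\<^sup>2) = 0"
  using assms by algebra

lemma var_w_mult_TT:
  assumes "total_degree f = n" "n \<ge> 2"
  shows "var_w * TT f = var_u\<^sup>2 * AA f + var_u * var_v * BB f + var_v\<^sup>2 * CC f"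
proof -
  let ?S = "var_u\<^sup>2 * AA f + var_u * var_v * BB f + var_v\<^sup>2 * CC f"
  define g where "g = hom_part n f"
  have hom: "homogeneous n g"
    unfolding g_def by (rule homogeneous_hom_part)
  have w: "var_w * q = pCons 0 q" for q
    by (simp add: var_w_def)
  have "xx * dx (dx g) + yy * dy (dx g) = of_nat (n - 1) * dx g"
    by (rule euler_homogeneous[OF homogeneous_dx[OF hom]])
  moreover have "xx * dy (dx g) + yy * dy (dy g) = of_nat (n - 1) * dy g"
    using euler_homogeneous[OF homogeneous_dy[OF hom]] by (simp only: dx_dy_commute)
  ultimately have "coeff ?S 0 = 0"
    using radial_contraction_vanishes[of xx "dx (dx g)" yy "dy (dx g)" "of_nat (n - 1)" "dx g" "dy (dy g)" "dy g"]
    by (simp add: coeff_AA_BB_CC_0[OF assms] coeff_mult_0 coeff_0_power mult.commute[of yy xx] var_u_def var_v_def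
        xx_def[symmetric] yy_def[symmetric] flip: g_def)
  then obtain T where T: "?S = var_w * T"
    by (cases ?S) (auto simp: w)
  then have "TT f = T"
    unfolding TT_def by (intro the_equality) (auto simp: w)
  with T show ?thesis by simp
qed

lemma coeff_TT_0:
  assumes "total_degree f = n" "n \<ge> 2"
  shows "coeff (TT f) 0 = xx\<^sup>2 * coeff (AA f) (Suc 0) + xx * yy * coeff (BB f) (Suc 0)
      + yy\<^sup>2 * coeff (CC f) (Suc 0)"
proof -
  have "coeff (TT f) 0 = coeff (var_w * TT f) (Suc 0)"
    by (simp add: var_w_def)
  then show ?thesis
    unfolding var_w_mult_TT[OF assms]
    by (simp add: coeff_mult_0 coeff_mult_Suc_0 power2_eq_square var_u_def var_v_def
        xx_def[symmetric] yy_def[symmetric])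
qed

text \<open>The vector \<open>(2 u A + v B, u B + 2 v C)\<close> is orthogonal to \<open>(u, v)\<close> by
  \<open>radial_contraction_vanishes\<close>, hence a multiple of \<open>(- v, u)\<close>. The multiplier is \<open>t p\<^sup>2 + r q\<^sup>2 - 2 s p q\<close>, the Hessian form of \<open>g\<close>
  evaluated at \<open>(q, - p)\<close>; Euler's identity turns \<open>m\<close> times it into \<open>N g\<close> times the Hessian.\<close>

lemma mixed_coefficients_identity:
  fixes u v m N g p q r s t :: "'a::idom"
  assumes "u * r + v * s = m * p" and "u * s + v * t = m * q" and "u * p + v * q = N * g"
  defines "A \<equiv> s * p\<^sup>2 - r * p * q" and "B \<equiv> t * p\<^sup>2 - r * q\<^sup>2" and "C \<equiv> t * p * q - s * q\<^sup>2"
  shows "m * (2 * u * A + v * B) = - v * (N * g * (r * t - s\<^sup>2))"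
    and "m * (u * B + 2 * v * C) = u * (N * g * (r * t - s\<^sup>2))"
  using assms(1-3) unfolding A_def B_def C_def by algebra+

text \<open>The left-hand side is the coefficient of \<open>\<omega>\<close> in \<open>u\<^sup>2 A + u v B + v\<^sup>2 C\<close>, that is, \<open>T\<close> at \<open>\<omega> = 0\<close>. It
  is the first-order variation of the vanishing radial contraction when \<open>g\<close> is replaced by
  \<open>g + \<omega> h\<close>. It would vanish if \<open>h\<close> had the degree of \<open>g\<close>; only the drop of the degree by one, which
  is the factor \<open>m - 1\<close> in place of \<open>m\<close>, contributes.\<close>

lemma last_coefficient_identity:
  fixes u v m N g p q r s t p' q' r' s' t' :: "'a::idom"
  assumes "u * r + v * s = m * p" and "u * s + v * t = m * q" and "u * p + v * q = N * g"
    and "u * r' + v * s' = (m - 1) * p'" and "u * s' + v * t' = (m - 1) * q'"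
  shows "u\<^sup>2 * (s' * p\<^sup>2 + 2 * s * p * p' - r' * p * q - r * p' * q - r * p * q')
      + u * v * (t' * p\<^sup>2 + 2 * t * p * p' - r' * q\<^sup>2 - 2 * r * q * q')
      + v\<^sup>2 * (t' * p * q + t * p' * q + t * p * q' - s' * q\<^sup>2 - 2 * s * q * q')
      = N * g * (p' * q - q' * p)"
  using assms by algebra

lemma flat_point_at_infinity:
  assumes deg: "total_degree f = n" "n \<ge> 2" and flat: "(u, v, 0) \<in> flat_points f"
  defines "g \<equiv> hom_part n f" and "h \<equiv> hom_part (n - 1) f"
  shows "eval2 g u v = 0 \<or>
    (eval2 (dot (grad h) (perp (grad g))) u v = 0 \<and> eval2 (det_Hess g) u v = 0)"
proof -
  let ?e = "\<lambda>p. eval2 p u v"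
  define m where "m = real n - 1"
  have homg: "homogeneous n g" and homh: "homogeneous (n - 1) h"
    unfolding g_def h_def by (rule homogeneous_hom_part)+
  have nz: "(u, v) \<noteq> (0, 0)"
    using flat by (auto simp: flat_points_def norm_prod_def)
  have m: "real (n - 1) = m" "real (n - 1 - 1) = m - 1" "m \<noteq> 0"
    using deg(2) by (simp_all add: m_def of_nat_diff)
  have euler:
    "u * ?e (dx (dx g)) + v * ?e (dy (dx g)) = m * ?e (dx g)"
    "u * ?e (dy (dx g)) + v * ?e (dy (dy g)) = m * ?e (dy g)"
    "u * ?e (dx g) + v * ?e (dy g) = real n * ?e g"
    "u * ?e (dx (dx h)) + v * ?e (dy (dx h)) = (m - 1) * ?e (dx h)"
    "u * ?e (dy (dx h)) + v * ?e (dy (dy h)) = (m - 1) * ?e (dy h)"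
    using euler_at_point[OF homogeneous_dx[OF homg], of u v]
      euler_at_point[OF homogeneous_dy[OF homg], of u v] euler_at_point[OF homg, of u v]
      euler_at_point[OF homogeneous_dx[OF homh], of u v]
      euler_at_point[OF homogeneous_dy[OF homh], of u v]
    unfolding dx_dy_commute m(1) m(2) by blast+
  have zero: "?e (coeff p 0) = 0" if "p \<in> set (Phi_coeffs f)" for p
    using flat that by (auto simp: flat_points_def eval3_equator)
  have "?e (coeff (- (2 * var_u * AA f + var_v * BB f)) 0) = 0"
    by (rule zero) (simp add: Phi_coeffs_def)
  then have D1: "2 * u * ?e (coeff (AA f) 0) + v * ?e (coeff (BB f) 0) = 0"
    by (simp add: coeff_mult_0 var_u_def var_v_def xx_def[symmetric] yy_def[symmetric]
        mult.assoc coeff_two_0)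
  have "?e (coeff (- (var_u * BB f + 2 * var_v * CC f)) 0) = 0"
    by (rule zero) (simp add: Phi_coeffs_def)
  then have D2: "u * ?e (coeff (BB f) 0) + 2 * v * ?e (coeff (CC f) 0) = 0"
    by (simp add: coeff_mult_0 var_u_def var_v_def xx_def[symmetric] yy_def[symmetric]
        mult.assoc coeff_two_0)
  have H: "?e g * ?e (det_Hess g) = 0"
  proof -
    note mixed_coefficients_identity[OF euler(1-3)]
    with D1 D2 have "v * (real n * ?e g * ?e (det_Hess g)) = 0"
      "u * (real n * ?e g * ?e (det_Hess g)) = 0"
      by (simp_all add: coeff_AA_BB_CC_0[OF deg] det_Hess_def flip: g_def)
    then show ?thesis
      using nz deg(2) by auto
  qed
  have "?e (coeff (TT f) 0) = 0"
    by (rule zero) (simp add: Phi_coeffs_def)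
  then have J: "?e g * ?e (dot (grad h) (perp (grad g))) = 0"
    using last_coefficient_identity[OF euler] deg(2)
    by (simp add: coeff_TT_0[OF deg] coeff_AA_BB_CC_1[OF deg, folded g_def h_def] dot_def grad_def
        perp_def)
  from H J show ?thesis by auto
qed

theorem theorem4p6:
  fixes f :: "real poly poly" and n L K :: nat
  assumes "total_degree f = n" and "n \<ge> 2"
    and "num_up_to_scalars {l. linear_factor l (hom_part n f)} = L"
    and "\<forall>l. linear_factor l (hom_part n f) \<longrightarrow> \<not> l^2 dvd hom_part n f"
    and "num_up_to_scalars
           {l. linear_factor l (dot (grad (hom_part (n - 1) f)) (perp (grad (hom_part n f)))) \<and>
               linear_factor l (det_Hess (hom_part n f))} = K"
  shows "finite (umbilics_at_infinity f) \<and> card (umbilics_at_infinity f) \<le> 2 * L + 2 * K"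
proof -
  define g where "g = hom_part n f"
  define h where "h = hom_part (n - 1) f"
  define J where "J = dot (grad h) (perp (grad g))"
  let ?SL = "{l. linear_factor l g}"
  let ?SK = "{l. linear_factor l J \<and> linear_factor l (det_Hess g)}"
  have homg: "homogeneous n g" and homh: "homogeneous (n - 1) h"
    unfolding g_def h_def by (rule homogeneous_hom_part)+
  have "g \<noteq> 0"
    unfolding g_def using hom_part_total_degree_nonzero[OF assms(1)] assms(2) by simp
  have "det_Hess g \<noteq> 0"
  proof
    assume "det_Hess g = 0"
    then obtain l where "total_degree l = 1" "l\<^sup>2 dvd g"
      using repeated_factor_if_det_Hess_zero[OF homg assms(2)] by auto
    then show False
      using assms(4) dvd_trans[of l "l\<^sup>2" g] unfolding linear_factor_def g_def
      by (simp add: power2_eq_square)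
  qed
  have homH: "homogeneous ((n - 1 - 1) + (n - 1 - 1)) (det_Hess g)"
    unfolding det_Hess_def power2_eq_square
    by (intro homogeneous_diff homogeneous_mult homogeneous_dx homogeneous_dy homg)
  have J_alt: "J = dx h * dy g - dy h * dx g"
    by (simp add: J_def dot_def grad_def perp_def)
  have homJ: "homogeneous ((n - 1 - 1) + (n - 1)) J"
    unfolding J_alt
    by (intro homogeneous_diff homogeneous_mult homogeneous_dx homogeneous_dy homg homh)
  define ZL where "ZL = {z \<in> sphere 0 1. eval2 g (fst z) (snd z) = 0}"
  define ZK where "ZK = {z \<in> sphere 0 1. eval2 J (fst z) (snd z) = 0
      \<and> eval2 (det_Hess g) (fst z) (snd z) = 0}"
  have line_factor: "linear_factor (line_through z) p"
    if "homogeneous d p" "eval2 p (fst z) (snd z) = 0" "z \<in> sphere 0 1" for d p z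
  proof -
    have "z \<noteq> (0, 0)" using that(3) by (auto simp: norm_prod_def)
    then show ?thesis
      using total_degree_line_through[of z] line_through_dvd[of d p "fst z" "snd z"] that
      by (simp add: linear_factor_def)
  qed
  have "finite ZL \<and> card ZL \<le> 2 * num_up_to_scalars ?SL"
  proof (rule card_circle_points_le)
    show "finite (scalar_class ` ?SL)"
      by (rule finite_subset[OF _ finite_scalar_classes_of_divisors[OF \<open>g \<noteq> 0\<close>]])
         (auto simp: linear_factor_def)
  qed (auto simp: ZL_def intro: line_factor[OF homg])
  moreover have "finite ZK \<and> card ZK \<le> 2 * num_up_to_scalars ?SK"
  proof (rule card_circle_points_le)
    show "finite (scalar_class ` ?SK)"
      by (rule finite_subset[OF _ finite_scalar_classes_of_divisors[OF \<open>det_Hess g \<noteq> 0\<close>]])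
         (auto simp: linear_factor_def)
  qed (auto simp: ZK_def intro: line_factor[OF homH] line_factor[OF homJ])
  moreover have "umbilics_at_infinity f \<subseteq> (\<lambda>(u, v). (u, v, 0)) ` (ZL \<union> ZK)"
  proof
    fix p assume "p \<in> umbilics_at_infinity f"
    then have eq: "p \<in> equator" and flat: "p \<in> flat_points f"
      by (auto simp: umbilics_at_infinity_def isolated_in_def)
    from eq obtain u v where p: "p = (u, v, 0)" "(u, v) \<in> sphere 0 1"
      by (auto simp: equator_def norm_prod_def)
    from flat_point_at_infinity[OF assms(1,2)] flat p have "(u, v) \<in> ZL \<union> ZK"
      by (auto simp: ZL_def ZK_def J_def g_def h_def)
    then show "p \<in> (\<lambda>(u, v). (u, v, 0)) ` (ZL \<union> ZK)"
      using p(1) by force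
  qed
  ultimately have fin: "finite (umbilics_at_infinity f)"
    and "card (umbilics_at_infinity f) \<le> card (ZL \<union> ZK)"
    by (auto intro: finite_subset card_image_le[THEN le_trans[rotated]]
        surj_card_le)
  moreover have "card (ZL \<union> ZK) \<le> card ZL + card ZK"
    by (rule card_Un_le)
  moreover have "card ZL \<le> 2 * L" "card ZK \<le> 2 * K"
    using \<open>finite ZL \<and> _\<close> \<open>finite ZK \<and> _\<close> assms(3,5) by (simp_all add: g_def h_def J_def)
  ultimately show ?thesis by linarith
qed

end
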